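(* Consider the two-period problem described in the context, under any of the four platform designs described there. Let $(\mathbf x^{1,\star},\mathbf w^{1,\star},\mathbf x^{2,\star})$ be an optimal solution of the mixed-integer program (DH-int) below, in which the same design restrictions are imposed: $$\max\ \sum_{e\in E}\beta^1_e w^1_e+\sum_{\ell\in I\cup J}\sum_{\ell'\in P_\ell}\phi^2_{\ell,\ell'}x^2_{\ell,\ell'}$$ subject to - $\sum_{\ell'\in P_\ell}x^1_{\ell,\ell'}+\sum_{e\in E:\ell\in e}w^1_e\le K_\ell$ for all $\ell\in I\cup J$, - $\sum_{\ell'\in P_\ell}x^2_{\ell,\ell'}\le K_\ell$ for all $\ell\in I\cup J$, - $x^1_{\ell,\ell'}+x^1_{\ell',\ell}+w^1_e\le 1$ for all $e=\{\ell,\ell'\}\in E$, - $x^2_{\ell,\ell'}\le\phi^1_{\ell',\ell}\,x^1_{\ell',\ell}$ for all $\ell\in I\cup J$, $\ell'\in P_\ell$, - $\mathbf x^1\in\{0,1\}^{\vec E}$, $\mathbf x^2\in[0,1]^{\vec E}$, $\mathbf w^1\in\{0,1\}^{E}$. Consider the algorithm that displays the profiles prescribed by $(\mathbf x^{1,\star},\mathbf w^{1,\star})$ in period 1 and then, after observing the realized set $R$ of arcs liked in period 1, displays an optimal solution of the second-period problem defining $f(R)$. This algorithm is a $(1-1/e)$-approximation for the two-period problem, i.e. $$\sum_{e\in E}\beta^1_e w^{1,\star}_e+\mathsf M^2(\mathbf x^{1,\star},\mathbf w^{1,\star})\ \ge\ \Big(1-\frac1e\Big)\cdot \mathrm{OPT},$$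 where $\mathrm{OPT}$ is the optimal value of the two-period problem under the same design.
   Context: Setting. $I$ and $J$ are finite disjoint sets of users. Each $\ell\in I\cup J$ has a positive integer $K_\ell$ and a set of potentials $P_\ell$, with $P_i\subseteq J$ for $i\in I$, $P_j\subseteq I$ for $j\in J$, and $\ell'\in P_\ell$ iff $\ell\in P_{\ell'}$. Let $E=\{\{i,j\}: i\in I, j\in P_i\}$, $\vec E_I=\{(i,j):i\in I,j\in P_i\}$, $\vec E_J=\{(j,i):j\in J,i\in P_j\}$, $\vec E=\vec E_I\cup\vec E_J$. For $t\in\{1,2\}$ and $(\ell,\ell')\in\vec E$, $\phi^t_{\ell,\ell'}\in[0,1]$ is the (history-independent) probability that $\ell$ likes $\ell'$ if $\ell'$ is shown to $\ell$ in period $t$; all like decisions are independent. For $e=\{\ell,\ell'\}$, $\beta^1_e=\phi^1_{\ell,\ell'}\phi^1_{\ell',\ell}$. There is no initial backlog, and non-sequential matches are not allowed in period 2. First-period decisions: $x^1_{\ell,\ell'}=1$ means $\ell'$ is shown to $\ell$ in period 1 to initiate a sequential interaction; $w^1_e=1$ means the two users of $e$ see each other in period 1 (non-sequential interaction). Second-period problem: for $R\subseteq\vec E$, $$f(R)=\max_{\mathbf x^2\in\{0,1\}^{\vec E}}\Big\{\sum_{(\ell,\ell')\in\vec E}\phi^2_{\ell,\ell'}x^2_{\ell,\ell'}:\ \sum_{\ell'\in P_\ell}x^2_{\ell,\ell'}\le K_\ell\ \forall \ell\in I\cup J,\ \ x^2_{\ell,\ell'}\le \mathbf 1_{\{(\ell',\ell)\in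 R\}}\ \forall(\ell,\ell')\in\vec E\Big\}.$$ Expected second-period matches (it does not depend on $\mathbf w^1$): $$\mathsf M^2(\mathbf x^1,\mathbf w^1)=\sum_{R\subseteq\vec E}f(R)\prod_{a\in R}\phi^1_a x^1_a\prod_{a\in\vec E\setminus R}(1-\phi^1_a x^1_a).$$ Two-period problem: maximize $\sum_{e\in E}\beta^1_e w^1_e+\mathsf M^2(\mathbf x^1,\mathbf w^1)$ over $\mathbf x^1\in\{0,1\}^{\vec E}$, $\mathbf w^1\in\{0,1\}^{E}$ subject to $\sum_{\ell'\in P_\ell}x^1_{\ell,\ell'}+\sum_{e\in E:\ell\in e}w^1_e\le K_\ell$ for all $\ell\in I\cup J$ and $x^1_{\ell,\ell'}+x^1_{\ell',\ell}+w^1_e\le1$ for all $e=\{\ell,\ell'\}\in E$. Platform designs (extra restrictions on the feasible region): (1) two-directional interactions with non-sequential matches allowed in period 1: no extra restriction; (2) two-directional, sequential matches only: $\mathbf w^1=0$; (3) one-directional with initiating side $I$, non-sequential matches allowed in period 1: $x^1_{j,i}=0$ for all $(j,i)\in\vec E_J$; (4) one-directional with initiating side $I$, sequential matches only: both $\mathbf w^1=0$ and $x^1_{j,i}=0$ for all $(j,i)\in\vec E_J$. *)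

theory Defs
  imports "HOL-Analysis.Analysis"
begin

text \<open>
  \<^term>\<open>like1\<close> and \<^term>\<open>like2\<close> map an arc \<open>(l, l')\<close> to the probability that \<open>l\<close> likes \<open>l'\<close>
  when \<open>l'\<close> is shown to \<open>l\<close> in period 1 and period 2, respectively.
\<close>

record 'u market =
  side_I :: "'u set"
  side_J :: "'u set"
  capacity :: "'u \<Rightarrow> nat"
  potentials :: "'u \<Rightarrow> 'u set"
  like1 :: "'u \<times> 'u \<Rightarrow> real"
  like2 :: "'u \<times> 'u \<Rightarrow> real"

definition users :: "'u market \<Rightarrow> 'u set" where
  "users M = side_I M \<union> side_J M"

definition arcs_I :: "'u market \<Rightarrow> ('u \<times> 'u) set" where
  "arcs_I M = (SIGMA i : side_I M. potentials M i)"

definition arcs_J :: "'u market \<Rightarrow> ('u \<times> 'u) set" where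
  "arcs_J M = (SIGMA j : side_J M. potentials M j)"

definition arcs :: "'u market \<Rightarrow> ('u \<times> 'u) set" where
  "arcs M = arcs_I M \<union> arcs_J M"

definition edges :: "'u market \<Rightarrow> 'u set set" where
  "edges M = {{i, j} | i j. i \<in> side_I M \<and> j \<in> potentials M i}"

definition valid_market :: "'u market \<Rightarrow> bool" where
  "valid_market M \<longleftrightarrow>
     finite (side_I M) \<and> finite (side_J M) \<and> side_I M \<inter> side_J M = {} \<and>
     (\<forall>l\<in>users M. capacity M l > 0) \<and>
     (\<forall>i\<in>side_I M. potentials M i \<subseteq> side_J M) \<and>
     (\<forall>j\<in>side_J M. potentials M j \<subseteq> side_I M) \<and>
     (\<forall>l\<in>users M. \<forall>l'\<in>users M. l' \<in> potentials M l \<longleftrightarrow> l \<in> potentials M l') \<and>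
     (\<forall>a\<in>arcs M. like1 M a \<in> {0..1} \<and> like2 M a \<in> {0..1})"

text \<open>
  The arcs with underlying edge \<open>{l, l'}\<close> are exactly \<open>(l, l')\<close> and \<open>(l', l)\<close>, so the product
  has two factors; see \<open>beta1_eq\<close> below.
\<close>

definition beta1 :: "'u market \<Rightarrow> 'u set \<Rightarrow> real" where
  "beta1 M e = (\<Prod>a \<in> {a \<in> arcs M. {fst a, snd a} = e}. like1 M a)"

text \<open>
  Decision vectors in \<open>S^A\<close> are elements of \<open>A \<rightarrow>\<^sub>E S\<close>, so that the binary feasible regions are
  finite sets and the maxima below can be taken with \<^const>\<open>Max\<close>.
\<close>

definition second_feasible :: "'u market \<Rightarrow> ('u \<times> 'u) set \<Rightarrow> ('u \<times> 'u \<Rightarrow> real) set" where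
  "second_feasible M R =
     {x2 \<in> arcs M \<rightarrow>\<^sub>E {0, 1}.
        (\<forall>l\<in>users M. (\<Sum>l'\<in>potentials M l. x2 (l, l')) \<le> real (capacity M l)) \<and>
        (\<forall>(l, l')\<in>arcs M. x2 (l, l') \<le> of_bool ((l', l) \<in> R))}"

definition second_value :: "'u market \<Rightarrow> ('u \<times> 'u) set \<Rightarrow> real" where
  "second_value M R = Max ((\<lambda>x2. \<Sum>a\<in>arcs M. like2 M a * x2 a) ` second_feasible M R)"

definition expected_second :: "'u market \<Rightarrow> ('u \<times> 'u \<Rightarrow> real) \<Rightarrow> real" where
  "expected_second M x1 =
     (\<Sum>R \<in> Pow (arcs M). second_value M R *
        (\<Prod>a\<in>R. like1 M a * x1 a) * (\<Prod>a\<in>arcs M - R. 1 - like1 M a * x1 a))"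

datatype design = Two_Directional | Two_Directional_Sequential
  | One_Directional | One_Directional_Sequential

text \<open>In both one-directional designs the initiating side is \<open>I\<close>.\<close>

fun design_ok ::
  "'u market \<Rightarrow> design \<Rightarrow> ('u \<times> 'u \<Rightarrow> real) \<Rightarrow> ('u set \<Rightarrow> real) \<Rightarrow> bool" where
  "design_ok M Two_Directional x1 w1 \<longleftrightarrow> True"
| "design_ok M Two_Directional_Sequential x1 w1 \<longleftrightarrow> (\<forall>e\<in>edges M. w1 e = 0)"
| "design_ok M One_Directional x1 w1 \<longleftrightarrow> (\<forall>a\<in>arcs_J M. x1 a = 0)"
| "design_ok M One_Directional_Sequential x1 w1 \<longleftrightarrow>
     (\<forall>e\<in>edges M. w1 e = 0) \<and> (\<forall>a\<in>arcs_J M. x1 a = 0)"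

definition first_feasible ::
  "'u market \<Rightarrow> design \<Rightarrow> (('u \<times> 'u \<Rightarrow> real) \<times> ('u set \<Rightarrow> real)) set" where
  "first_feasible M d =
     {(x1, w1). x1 \<in> arcs M \<rightarrow>\<^sub>E {0, 1} \<and> w1 \<in> edges M \<rightarrow>\<^sub>E {0, 1} \<and>
        (\<forall>l\<in>users M. (\<Sum>l'\<in>potentials M l. x1 (l, l')) + (\<Sum>e\<in>{e\<in>edges M. l \<in> e}. w1 e)
           \<le> real (capacity M l)) \<and>
        (\<forall>(l, l')\<in>arcs M. x1 (l, l') + x1 (l', l) + w1 {l, l'} \<le> 1) \<and>
        design_ok M d x1 w1}"

definition two_period_value ::
  "'u market \<Rightarrow> ('u \<times> 'u \<Rightarrow> real) \<Rightarrow> ('u set \<Rightarrow> real) \<Rightarrow> real" where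
  "two_period_value M x1 w1 = (\<Sum>e\<in>edges M. beta1 M e * w1 e) + expected_second M x1"

definition OPT :: "'u market \<Rightarrow> design \<Rightarrow> real" where
  "OPT M d = Max ((\<lambda>(x1, w1). two_period_value M x1 w1) ` first_feasible M d)"

definition DH_feasible ::
  "'u market \<Rightarrow> design \<Rightarrow>
     (('u \<times> 'u \<Rightarrow> real) \<times> ('u set \<Rightarrow> real) \<times> ('u \<times> 'u \<Rightarrow> real)) set" where
  "DH_feasible M d =
     {(x1, w1, x2). (x1, w1) \<in> first_feasible M d \<and> x2 \<in> arcs M \<rightarrow>\<^sub>E {0..1} \<and>
        (\<forall>l\<in>users M. (\<Sum>l'\<in>potentials M l. x2 (l, l')) \<le> real (capacity M l)) \<and>
        (\<forall>l\<in>users M. \<forall>l'\<in>potentials M l. x2 (l, l') \<le> like1 M (l', l) * x1 (l', l))}"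

definition DH_value ::
  "'u market \<Rightarrow> ('u set \<Rightarrow> real) \<Rightarrow> ('u \<times> 'u \<Rightarrow> real) \<Rightarrow> real" where
  "DH_value M w1 x2 =
     (\<Sum>e\<in>edges M. beta1 M e * w1 e) +
     (\<Sum>l\<in>users M. \<Sum>l'\<in>potentials M l. like2 M (l, l') * x2 (l, l'))"

definition DH_optimal ::
  "'u market \<Rightarrow> design \<Rightarrow>
     ('u \<times> 'u \<Rightarrow> real) \<Rightarrow> ('u set \<Rightarrow> real) \<Rightarrow> ('u \<times> 'u \<Rightarrow> real) \<Rightarrow> bool" where
  "DH_optimal M d x1 w1 x2 \<longleftrightarrow>
     (x1, w1, x2) \<in> DH_feasible M d \<and>
     (\<forall>(y1, v1, y2)\<in>DH_feasible M d. DH_value M v1 y2 \<le> DH_value M w1 x2)"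

lemma beta1_eq:
  assumes "valid_market M" "(l, l') \<in> arcs M"
  shows "beta1 M {l, l'} = like1 M (l, l') * like1 M (l', l)"
proof -
  have "(l', l) \<in> arcs M" and ne: "l \<noteq> l'"
    using assms
    unfolding valid_market_def arcs_def arcs_I_def arcs_J_def users_def by blast+
  then have "{a \<in> arcs M. {fst a, snd a} = {l, l'}} = {(l, l'), (l', l)}"
    using assms(2) by (auto simp: doubleton_eq_iff)
  then show ?thesis
    using ne by (simp add: beta1_def)
qed

lemma finite_arcs:
  assumes "valid_market M"
  shows "finite (arcs M)"
proof -
  have "arcs M \<subseteq> users M \<times> users M" "finite (users M)"
    using assms unfolding valid_market_def arcs_def arcs_I_def arcs_J_def users_def by auto
  then show ?thesis
    by (meson finite_SigmaI finite_subset)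
qed

lemma finite_edges:
  assumes "valid_market M"
  shows "finite (edges M)"
proof -
  have "edges M \<subseteq> (\<lambda>(l, l'). {l, l'}) ` arcs M"
    unfolding edges_def arcs_def arcs_I_def by auto
  then show ?thesis
    using finite_arcs[OF assms] finite_surj by blast
qed

lemma finite_second_feasible:
  "valid_market M \<Longrightarrow> finite (second_feasible M R)"
  unfolding second_feasible_def by (simp add: finite_arcs finite_PiE)

lemma sum_zero_arcs:
  assumes "l \<in> users M"
  shows "(\<Sum>l'\<in>potentials M l. restrict (\<lambda>_. 0) (arcs M) (l, l')) = (0::real)"
  using assms by (intro sum.neutral) (auto simp: arcs_def arcs_I_def arcs_J_def users_def)

lemma second_feasible_nonempty:
  "second_feasible M R \<noteq> {}"
proof -
  have "restrict (\<lambda>_. 0) (arcs M) \<in> second_feasible M R"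
    unfolding second_feasible_def
    by (auto simp: sum_zero_arcs simp del: restrict_apply) simp_all
  then show ?thesis by blast
qed

lemma finite_first_feasible:
  assumes "valid_market M"
  shows "finite (first_feasible M d)"
proof (rule finite_subset)
  show "first_feasible M d \<subseteq> (arcs M \<rightarrow>\<^sub>E {0, 1}) \<times> (edges M \<rightarrow>\<^sub>E {0, 1})"
    unfolding first_feasible_def by auto
  show "finite ((arcs M \<rightarrow>\<^sub>E {0, 1::real}) \<times> (edges M \<rightarrow>\<^sub>E {0, 1::real}))"
    using assms by (simp add: finite_arcs finite_edges finite_PiE)
qed

lemma first_feasible_nonempty:
  assumes "valid_market M"
  shows "first_feasible M d \<noteq> {}"
proof -
  have arc: "(l', l) \<in> arcs M" "{l, l'} \<in> edges M" if "(l, l') \<in> arcs M" for l l'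
    using assms that unfolding valid_market_def arcs_def arcs_I_def arcs_J_def users_def edges_def
    by blast+
  define x where "x = restrict (\<lambda>_. 0 :: real) (arcs M)"
  define w where "w = restrict (\<lambda>_. 0 :: real) (edges M)"
  have x: "x \<in> arcs M \<rightarrow>\<^sub>E {0, 1}" "\<And>a. a \<in> arcs M \<Longrightarrow> x a = 0"
    and w: "w \<in> edges M \<rightarrow>\<^sub>E {0, 1}" "\<And>e. e \<in> edges M \<Longrightarrow> w e = 0"
    by (auto simp: x_def w_def)
  have "design_ok M d x w"
    by (cases d) (auto simp: x w arcs_def)
  then have "(x, w) \<in> first_feasible M d"
    unfolding first_feasible_def
    using x w sum_zero_arcs[of _ M, folded x_def] arc by auto
  then show ?thesis by blast
qed

end

theory Submission
  imports Defs
begin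

text \<open>
  Averaging the optimal second-period decisions over \<open>R\<close> gives a feasible point of (DH-int), so the
  value of (DH-int) bounds the two-period optimum from above. For the converse, the second-period
  problem separates over users, and the weighted problem of a single user with capacity \<open>K\<close> reduces,
  by Abel summation over the superlevel sets of the weights, to the unweighted bound
  \<open>E (min K N) \<ge> (1 - 1/e) * \<mu>\<close> where \<open>N\<close> is a sum of independent Bernoulli variables with mean at
  least \<open>\<mu> \<le> K\<close>. This bound follows from \<open>min K n \<ge> K * (1 - (1 - 1/K) ^ n)\<close>, because the expectation
  of \<open>(1 - 1/K) ^ N\<close> is a product of factors \<open>1 - q/K \<le> exp (- q/K)\<close>.
\<close>

section \<open>Superlevel sets and greedy selection\<close>

text \<open>Superlevel sets as closure under larger weight, without naming a threshold. Ties are in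
  or out together; the empty set and \<open>A\<close> both qualify.\<close>

definition upper_in :: "('a \<Rightarrow> real) \<Rightarrow> 'a set \<Rightarrow> 'a set \<Rightarrow> bool" where
  "upper_in v A S \<longleftrightarrow> S \<subseteq> A \<and> (\<forall>a\<in>S. \<forall>b\<in>A. v a \<le> v b \<longrightarrow> b \<in> S)"

text \<open>Abel summation: the weighted sum is a nonnegative combination of sums of
  \<open>c\<close> over superlevel sets. The induction peels off the lowest level, splitting
  \<open>v\<close> into the constant \<open>m\<close> on \<open>A\<close> and \<open>v - m\<close>
  on the rest.\<close>

lemma sum_nonneg_of_upper_sums_nonneg:
  fixes v c :: "'a \<Rightarrow> real"
  assumes "finite A" "\<And>a. a \<in> A \<Longrightarrow> 0 \<le> v a"
    and "\<And>S. upper_in v A S \<Longrightarrow> 0 \<le> sum c S"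
  shows "0 \<le> (\<Sum>a\<in>A. v a * c a)"
  using assms
proof (induction A arbitrary: v rule: finite_psubset_induct)
  case (psubset A)
  show ?case
  proof (cases "A = {}")
    case False
    define m where "m = Min (v ` A)"
    define B where "B = {a\<in>A. m < v a}"
    have min: "m \<le> v a" if "a \<in> A" for a
      using that psubset.hyps by (simp add: m_def)
    have "m \<in> v ` A"
      using False psubset.hyps by (simp add: m_def)
    then have "B \<subset> A" "0 \<le> m"
      using psubset.prems(1) by (auto simp: B_def)
    have "0 \<le> (\<Sum>a\<in>B. (v a - m) * c a)"
    proof (rule psubset.IH[OF \<open>B \<subset> A\<close>])
      fix S assume "upper_in (\<lambda>a. v a - m) B S"
      \<comment> \<open>\<open>B\<close> is itself upward closed in \<open>A\<close>, so its
        superlevel sets are superlevel sets of \<open>A\<close>.\<close>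
      then have "upper_in v A S"
        unfolding upper_in_def B_def by fastforce
      then show "0 \<le> sum c S"
        by (rule psubset.prems(2))
    qed (simp add: B_def)
    also have "(\<Sum>a\<in>B. (v a - m) * c a) = (\<Sum>a\<in>A. (v a - m) * c a)"
      using psubset.hyps min by (intro sum.mono_neutral_left) (force simp: B_def)+
    also have "\<dots> = (\<Sum>a\<in>A. v a * c a) - m * sum c A"
      by (simp add: algebra_simps sum_subtractf sum_distrib_left)
    finally have "m * sum c A \<le> (\<Sum>a\<in>A. v a * c a)"
      by simp
    moreover have "0 \<le> sum c A"
      by (rule psubset.prems(2)) (simp add: upper_in_def)
    ultimately show ?thesis
      using \<open>0 \<le> m\<close> by (meson mult_nonneg_nonneg order_trans)
  qed simp
qed

text \<open>A single set of \<open>K\<close> heaviest elements (all of \<open>R\<close> if there are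
  fewer) fills every superlevel set as far as the capacity permits. Elements are inserted by
  decreasing weight.\<close>

lemma greedy_selection:
  fixes v :: "'a \<Rightarrow> real"
  assumes "finite R"
  shows "\<exists>T\<subseteq>R. card T \<le> K \<and> (\<forall>S. upper_in v R S \<longrightarrow> min K (card S) \<le> card (S \<inter> T))"
  using assms
proof (induction R rule: finite_ranking_induct[where f = "\<lambda>a. - v a"])
  case empty
  show ?case by (auto simp: upper_in_def)
next
  case (insert x R)
  then obtain T where T: "T \<subseteq> R" "card T \<le> K"
    and greedy: "\<And>S. upper_in v R S \<Longrightarrow> min K (card S) \<le> card (S \<inter> T)"
    by blast
  show ?case
  \<comment> \<open>The ranking induction allows \<open>x\<close> to be in \<open>R\<close>
    already.\<close>
  proof (cases "x \<in> R")
    case True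
    then show ?thesis
      using T greedy by (intro exI[of _ T]) (auto simp: insert_absorb)
  next
    case False
    have finT: "finite T"
      using T insert.hyps finite_subset by blast
    define T' where "T' = (if card T < K then insert x T else T)"
    have "min K (card S) \<le> card (S \<inter> T')" if S: "upper_in v (insert x R) S" for S
    proof (cases "x \<in> S")
      case True
      \<comment> \<open>As \<open>x\<close> has least weight, a superlevel set containing it is
        everything. The bound for \<open>R\<close> then says that a \<open>T\<close> with fewer than
        \<open>K\<close> elements is all of \<open>R\<close>.\<close>
      then have "S = insert x R"
        using S insert.hyps unfolding upper_in_def by fastforce
      moreover have "min K (card R) \<le> card (R \<inter> T)"
        by (rule greedy) (simp add: upper_in_def)
      moreover have "R \<inter> T = T" "insert x R \<inter> T = T" "insert x R \<inter> insert x T = insert x T"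
        using T by auto
      moreover have "x \<notin> T"
        using T False by blast
      ultimately show ?thesis
        using False insert.hyps finT by (auto simp: T'_def)
    next
      case False
      then have "upper_in v R S"
        using S unfolding upper_in_def by auto
      then have "min K (card S) \<le> card (S \<inter> T)"
        by (rule greedy)
      also have "S \<inter> T' = S \<inter> T"
        using False by (auto simp: T'_def)
      then have "card (S \<inter> T) = card (S \<inter> T')"
        by simp
      finally show ?thesis .
    qed
    moreover have "T' \<subseteq> insert x R" "card T' \<le> K"
      using T finT by (auto simp: T'_def card_insert_if)
    ultimately show ?thesis
      by blast
  qed
qed

section \<open>Random subsets with independent elements\<close>

text \<open>The law of a random subset that contains each \<open>a\<close> independently with
  probability \<open>q a\<close>. Expectations are finite sums over \<open>Pow A\<close> with these
  weights.\<close>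

definition subset_prob :: "('a \<Rightarrow> real) \<Rightarrow> 'a set \<Rightarrow> 'a set \<Rightarrow> real" where
  "subset_prob q A R = (\<Prod>a\<in>R. q a) * (\<Prod>a\<in>A - R. 1 - q a)"

lemma subset_prob_nonneg:
  assumes "\<And>a. a \<in> A \<Longrightarrow> q a \<in> {0..1}" "R \<subseteq> A"
  shows "0 \<le> subset_prob q A R"
  unfolding subset_prob_def using assms
  by (intro mult_nonneg_nonneg prod_nonneg) auto

text \<open>Expanding the right-hand product gives one summand per subset \<open>R\<close>. Suitable
  \<open>g\<close> yield the total mass, the marginals and the generating function of a
  count.\<close>

lemma expectation_prod:
  assumes "finite A"
  shows "(\<Sum>R\<in>Pow A. subset_prob q A R * (\<Prod>a\<in>R. g a)) = (\<Prod>a\<in>A. q a * g a + (1 - q a))"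
  using assms
  by (simp add: prod_add subset_prob_def prod.distrib mult_ac)

lemma sum_subset_prob:
  assumes "finite A"
  shows "(\<Sum>R\<in>Pow A. subset_prob q A R) = 1"
  using expectation_prod[OF assms, of q "\<lambda>_. 1"] by simp

text \<open>Absence of \<open>a\<close>, unlike presence, is a product of indicators over the
  elements of \<open>R\<close>; the product formula gives its probability, and the claim follows by
  complement.\<close>

lemma expectation_mem:
  assumes "finite A" "a \<in> A"
  shows "(\<Sum>R\<in>Pow A. subset_prob q A R * of_bool (a \<in> R)) = q a"
proof -
  have "(\<Sum>R\<in>Pow A. subset_prob q A R * of_bool (a \<notin> R))
      = (\<Sum>R\<in>Pow A. subset_prob q A R * (\<Prod>b\<in>R. of_bool (b \<noteq> a)))"
  proof (intro sum.cong refl)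
    fix R assume "R \<in> Pow A"
    then have "finite R"
      using assms finite_subset by blast
    then have "of_bool (a \<notin> R) = (\<Prod>b\<in>R. of_bool (b \<noteq> a) :: real)"
      by (cases "a \<in> R") (auto intro!: prod.neutral)
    then show "subset_prob q A R * of_bool (a \<notin> R)
        = subset_prob q A R * (\<Prod>b\<in>R. of_bool (b \<noteq> a))"
      by simp
  qed
  also have "\<dots> = (\<Prod>b\<in>A. q b * of_bool (b \<noteq> a) + (1 - q b))"
    using assms by (simp add: expectation_prod)
  also have "\<dots> = (\<Prod>b\<in>A. if b = a then 1 - q a else 1)"
    by (intro prod.cong) auto
  also have "\<dots> = 1 - q a"
    using assms by simp
  finally have "(\<Sum>R\<in>Pow A. subset_prob q A R * of_bool (a \<notin> R)) = 1 - q a" .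
  moreover have "(\<Sum>R\<in>Pow A. subset_prob q A R * of_bool (a \<in> R))
      + (\<Sum>R\<in>Pow A. subset_prob q A R * of_bool (a \<notin> R)) = (\<Sum>R\<in>Pow A. subset_prob q A R)"
    unfolding sum.distrib[symmetric] by (intro sum.cong) auto
  ultimately show ?thesis
    using sum_subset_prob[OF assms(1), of q] by simp
qed

section \<open>Truncated sums of independent Bernoulli variables\<close>

text \<open>Bernoulli's inequality at \<open>- 1 / K\<close> covers \<open>n \<le> K\<close>; beyond
  that the left side is still at most \<open>K\<close>.\<close>

lemma min_ge_one_minus_power:
  assumes "K > 0"
  shows "real K * (1 - (1 - 1 / real K) ^ n) \<le> real (min K n)"
proof (cases "n \<le> K")
  case True
  have "1 - real n / real K \<le> (1 - 1 / real K) ^ n"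
    using Bernoulli_inequality[of "- 1 / real K" n] assms by simp
  then have "real K * (1 - (1 - 1 / real K) ^ n) \<le> real K * (real n / real K)"
    by (intro mult_left_mono) auto
  then show ?thesis
    using True assms by simp
next
  case False
  have "0 \<le> (1 - 1 / real K) ^ n"
    using assms by simp
  then have "real K * (1 - (1 - 1 / real K) ^ n) \<le> real K * 1"
    by (intro mult_left_mono) auto
  then show ?thesis
    using False by simp
qed

text \<open>By convexity, \<open>exp\<close> lies below its chord over the interval from
  \<open>-1\<close> to \<open>0\<close>.\<close>

lemma one_minus_exp_ge:
  fixes s :: real
  assumes "0 \<le> s" "s \<le> 1"
  shows "(1 - 1 / exp 1) * s \<le> 1 - exp (- s)"
  using convex_onD[OF exp_convex, of s 0 "-1"] assms
  by (simp add: exp_minus field_simps)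

text \<open>The true mean \<open>sum q S\<close> may far exceed \<open>K\<close>, which caps the
  truncated count. The bound is therefore stated for a \<open>y\<close> below \<open>q\<close> whose
  total respects the capacity.\<close>

lemma expected_min_card:
  fixes q y :: "'a \<Rightarrow> real"
  assumes A: "finite A" "S \<subseteq> A" and K: "K > 0"
    and q: "\<And>a. a \<in> A \<Longrightarrow> q a \<in> {0..1}"
    and y: "\<And>a. a \<in> S \<Longrightarrow> y a \<in> {0..q a}" "sum y S \<le> real K"
  shows "(1 - 1 / exp 1) * sum y S
    \<le> (\<Sum>R\<in>Pow A. subset_prob q A R * real (min K (card (R \<inter> S))))"
proof -
  define c where "c = 1 - 1 / real K"
  \<comment> \<open>The factor 1 outside \<open>S\<close> makes the product over \<open>R\<close>
    count only \<open>R \<inter> S\<close>.\<close>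
  define g where "g = (\<lambda>a. if a \<in> S then c else 1)"
  define \<mu> where "\<mu> = sum y S"
  have \<mu>: "0 \<le> \<mu>" "\<mu> \<le> real K"
    using y by (auto simp: \<mu>_def intro!: sum_nonneg)
  have g: "(\<Prod>a\<in>R. g a) = c ^ card (R \<inter> S)" if "R \<subseteq> A" for R
  proof -
    have "finite R"
      using that A(1) finite_subset by blast
    then show ?thesis
      by (simp add: g_def prod.If_cases Int_def)
  qed
  have "(\<Prod>a\<in>A. q a * g a + (1 - q a)) = (\<Prod>a\<in>A. if a \<in> S then 1 - q a / real K else 1)"
    by (intro prod.cong) (auto simp: g_def c_def algebra_simps)
  also have "\<dots> = (\<Prod>a\<in>S. 1 - q a / real K)"
    using A by (simp add: prod.inter_restrict[symmetric] Int_absorb1)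
  also have "\<dots> \<le> (\<Prod>a\<in>S. exp (- (y a / real K)))"
  proof (intro prod_mono conjI)
    fix a assume "a \<in> S"
    then have a: "q a \<le> 1" "y a \<le> q a"
      using q y A by force+
    then show "0 \<le> 1 - q a / real K"
      using K by (simp add: field_simps)
    have "1 - q a / real K \<le> 1 + - (y a / real K)"
      using a K by (simp add: divide_right_mono)
    also have "\<dots> \<le> exp (- (y a / real K))"
      by (rule exp_ge_add_one_self)
    finally show "1 - q a / real K \<le> exp (- (y a / real K))" .
  qed
  also have "\<dots> = exp (- (\<mu> / real K))"
    using A by (simp add: exp_sum[symmetric] finite_subset sum_negf sum_divide_distrib \<mu>_def)
  finally have prod_le: "(\<Prod>a\<in>A. q a * g a + (1 - q a)) \<le> exp (- (\<mu> / real K))" .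
  \<comment> \<open>The capacity bound on \<open>y\<close> places \<open>\<mu> / K\<close> in the
    unit interval, where the chord bound applies.\<close>
  have "(1 - 1 / exp 1) * (\<mu> / real K) \<le> 1 - exp (- (\<mu> / real K))"
    using \<mu> K by (intro one_minus_exp_ge) auto
  then have "real K * ((1 - 1 / exp 1) * (\<mu> / real K))
      \<le> real K * (1 - (\<Prod>a\<in>A. q a * g a + (1 - q a)))"
    using prod_le by (intro mult_left_mono) auto
  also have "real K * ((1 - 1 / exp 1) * (\<mu> / real K)) = (1 - 1 / exp 1) * \<mu>"
    using K by simp
  also have "real K * (1 - (\<Prod>a\<in>A. q a * g a + (1 - q a)))
      = real K * ((\<Sum>R\<in>Pow A. subset_prob q A R) - (\<Sum>R\<in>Pow A. subset_prob q A R * (\<Prod>a\<in>R. g a)))"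
    using A by (simp add: expectation_prod sum_subset_prob)
  also have "\<dots> = (\<Sum>R\<in>Pow A. subset_prob q A R * (real K * (1 - (\<Prod>a\<in>R. g a))))"
    by (simp add: sum_subtractf[symmetric] sum_distrib_left algebra_simps)
  also have "\<dots> \<le> (\<Sum>R\<in>Pow A. subset_prob q A R * real (min K (card (R \<inter> S))))"
    using q g min_ge_one_minus_power[OF K]
    by (intro sum_mono mult_left_mono subset_prob_nonneg) (auto simp: c_def)
  finally show ?thesis
    by (simp add: \<mu>_def)
qed

text \<open>Both sides are linear in \<open>v\<close>, so Abel summation reduces the claim to
  superlevel sets, where the weights disappear and the greedy count is at least the truncated one.
  \<open>T\<close> is exposed for every \<open>R\<close> so that feasibility can be checked
  realization by realization.\<close>

lemma correlation_gap:
  fixes q v y :: "'a \<Rightarrow> real"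
  assumes A: "finite A" "B \<subseteq> A" and K: "K > 0"
    and q: "\<And>a. a \<in> A \<Longrightarrow> q a \<in> {0..1}"
    and v: "\<And>a. a \<in> B \<Longrightarrow> 0 \<le> v a"
    and y: "\<And>a. a \<in> B \<Longrightarrow> y a \<in> {0..q a}" "sum y B \<le> real K"
  obtains T where "\<And>R. R \<subseteq> A \<Longrightarrow> T R \<subseteq> R \<inter> B" "\<And>R. R \<subseteq> A \<Longrightarrow> card (T R) \<le> K"
    "(1 - 1 / exp 1) * (\<Sum>a\<in>B. v a * y a)
      \<le> (\<Sum>R\<in>Pow A. subset_prob q A R * (\<Sum>a\<in>B. v a * of_bool (a \<in> T R)))"
proof -
  have finB: "finite B"
    using A finite_subset by blast
  have "\<forall>R. \<exists>T\<subseteq>R \<inter> B. card T \<le> K \<and>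
      (\<forall>S. upper_in v (R \<inter> B) S \<longrightarrow> min K (card S) \<le> card (S \<inter> T))"
    using finB by (intro allI greedy_selection) simp
  then obtain T where T: "\<And>R. T R \<subseteq> R \<inter> B" "\<And>R. card (T R) \<le> K"
    and greedy: "\<And>R S. upper_in v (R \<inter> B) S \<Longrightarrow> min K (card S) \<le> card (S \<inter> T R)"
    by metis
  \<comment> \<open>The probability that the greedy choice contains \<open>a\<close>.\<close>
  define p where "p = (\<lambda>a. \<Sum>R\<in>Pow A. subset_prob q A R * of_bool (a \<in> T R))"
  have "0 \<le> (\<Sum>a\<in>B. v a * (p a - (1 - 1 / exp 1) * y a))"
  proof (rule sum_nonneg_of_upper_sums_nonneg[OF finB v])
    fix S assume S: "upper_in v B S"
    then have SB: "S \<subseteq> B" and finS: "finite S"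
      using finB finite_subset by (auto simp: upper_in_def)
    have "sum y S \<le> sum y B"
      using y finB SB by (intro sum_mono2) auto
    then have "(1 - 1 / exp 1) * sum y S
        \<le> (\<Sum>R\<in>Pow A. subset_prob q A R * real (min K (card (R \<inter> S))))"
      using A K q y SB by (intro expected_min_card) auto
    also have "\<dots> \<le> (\<Sum>R\<in>Pow A. subset_prob q A R * real (card (S \<inter> T R)))"
    proof (intro sum_mono mult_left_mono subset_prob_nonneg q)
      fix R
      \<comment> \<open>A superlevel set of \<open>B\<close> meets each realization in a superlevel
        set of that realization.\<close>
      have "upper_in v (R \<inter> B) (R \<inter> S)"
        using S by (auto simp: upper_in_def)
      then have "min K (card (R \<inter> S)) \<le> card (R \<inter> S \<inter> T R)"
        by (rule greedy)
      also have "R \<inter> S \<inter> T R = S \<inter> T R"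
        using T by blast
      finally show "real (min K (card (R \<inter> S))) \<le> real (card (S \<inter> T R))"
        by simp
    qed auto
    also have "\<dots> = (\<Sum>R\<in>Pow A. \<Sum>a\<in>S. subset_prob q A R * of_bool (a \<in> T R))"
      using finS by (simp add: sum_distrib_left[symmetric] of_bool_def sum.If_cases Int_def)
    also have "\<dots> = sum p S"
      unfolding p_def by (rule sum.swap)
    finally show "0 \<le> (\<Sum>a\<in>S. p a - (1 - 1 / exp 1) * y a)"
      by (simp add: sum_subtractf sum_distrib_left)
  qed
  then have "(1 - 1 / exp 1) * (\<Sum>a\<in>B. v a * y a) \<le> (\<Sum>a\<in>B. v a * p a)"
    by (simp add: right_diff_distrib sum_subtractf sum_distrib_left mult.left_commute)
  also have "\<dots> = (\<Sum>a\<in>B. \<Sum>R\<in>Pow A. subset_prob q A R * (v a * of_bool (a \<in> T R)))"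
    by (simp add: p_def sum_distrib_left mult.left_commute)
  also have "\<dots> = (\<Sum>R\<in>Pow A. subset_prob q A R * (\<Sum>a\<in>B. v a * of_bool (a \<in> T R)))"
    by (subst sum.swap) (simp add: sum_distrib_left)
  finally show thesis
    using T that by blast
qed

section \<open>Markets\<close>

lemma arcs_iff: "(l, l') \<in> arcs M \<longleftrightarrow> l \<in> users M \<and> l' \<in> potentials M l"
  by (auto simp: arcs_def arcs_I_def arcs_J_def users_def)

lemma arcs_Sigma: "arcs M = (SIGMA l : users M. potentials M l)"
  by (auto simp: arcs_iff)

lemma arcs_sym:
  assumes "valid_market M" "(l, l') \<in> arcs M"
  shows "(l', l) \<in> arcs M"
  using assms unfolding valid_market_def arcs_def arcs_I_def arcs_J_def users_def by blast

lemma finite_potentials: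
  assumes "valid_market M" "l \<in> users M"
  shows "finite (potentials M l)"
proof -
  have "potentials M l \<subseteq> users M" "finite (users M)"
    using assms unfolding valid_market_def users_def by auto
  then show ?thesis
    by (rule finite_subset)
qed

text \<open>Grouping arcs by their first user matches the second-period capacity constraints and the
  form of \<open>DH_value\<close>.\<close>

lemma sum_arcs:
  fixes f :: "'u \<times> 'u \<Rightarrow> real"
  assumes "valid_market M"
  shows "(\<Sum>a\<in>arcs M. f a) = (\<Sum>l\<in>users M. \<Sum>l'\<in>potentials M l. f (l, l'))"
proof -
  have "finite (users M)"
    using assms by (auto simp: valid_market_def users_def)
  then show ?thesis
    unfolding arcs_Sigma by (subst sum.Sigma) (auto simp: finite_potentials[OF assms])
qed

lemma like_bounds:
  assumes "valid_market M" "a \<in> arcs M"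
  shows "like1 M a \<in> {0..1}" "like2 M a \<in> {0..1}"
  using assms by (auto simp: valid_market_def)

lemma beta1_nonneg:
  assumes "valid_market M"
  shows "0 \<le> beta1 M e"
  unfolding beta1_def using like_bounds[OF assms] by (intro prod_nonneg) auto

lemma like1_first_feasible:
  assumes "valid_market M" "(x1, w1) \<in> first_feasible M d" "a \<in> arcs M"
  shows "like1 M a * x1 a \<in> {0..1}"
proof -
  have "x1 a \<in> {0, 1}"
    using assms(2,3) by (auto simp: first_feasible_def)
  then show ?thesis
    using like_bounds[OF assms(1,3)] by auto
qed

lemma expected_second_eq:
  "expected_second M x1 =
    (\<Sum>R\<in>Pow (arcs M). subset_prob (\<lambda>a. like1 M a * x1 a) (arcs M) R * second_value M R)"
  by (simp add: expected_second_def subset_prob_def mult_ac)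

lemma second_value_ge:
  assumes "valid_market M" "x \<in> second_feasible M R"
  shows "(\<Sum>a\<in>arcs M. like2 M a * x a) \<le> second_value M R"
  unfolding second_value_def using assms by (intro Max_ge) (auto simp: finite_second_feasible)

lemma second_value_attained:
  assumes "valid_market M"
  obtains x where "x \<in> second_feasible M R" "second_value M R = (\<Sum>a\<in>arcs M. like2 M a * x a)"
proof -
  have "second_value M R \<in> (\<lambda>x2. \<Sum>a\<in>arcs M. like2 M a * x2 a) ` second_feasible M R"
    unfolding second_value_def using assms
    by (intro Max_in) (auto simp: finite_second_feasible second_feasible_nonempty)
  then show thesis
    using that by auto
qed

section \<open>Comparison of the two-period problem with (DH-int)\<close>

text \<open>The constraints and the objective are linear in the second-period decision, so averaging
  optimal decisions over \<open>R\<close> keeps feasibility and turns the expected value into the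
  (DH-int) value.\<close>

lemma two_period_value_eq_DH:
  assumes M: "valid_market M" and x1: "(x1, w1) \<in> first_feasible M d"
  obtains x2 where "(x1, w1, x2) \<in> DH_feasible M d" "two_period_value M x1 w1 = DH_value M w1 x2"
proof -
  define A where "A = arcs M"
  define q where "q = (\<lambda>a. like1 M a * x1 a)"
  have finA: "finite A"
    using M by (simp add: A_def finite_arcs)
  have q: "q a \<in> {0..1}" if "a \<in> A" for a
    using like1_first_feasible[OF M x1] that by (simp add: q_def A_def)
  have pr: "0 \<le> subset_prob q A R" if "R \<subseteq> A" for R
    using q that by (rule subset_prob_nonneg)
  have "\<exists>x. x \<in> second_feasible M R \<and> second_value M R = (\<Sum>a\<in>A. like2 M a * x a)" for R
    using second_value_attained[OF M] unfolding A_def by metis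
  then obtain X where X: "\<And>R. X R \<in> second_feasible M R"
    and val: "\<And>R. second_value M R = (\<Sum>a\<in>A. like2 M a * X R a)"
    by metis
  define z where "z = (\<lambda>a\<in>A. \<Sum>R\<in>Pow A. subset_prob q A R * X R a)"
  have X01: "X R a \<in> {0, 1}" if "a \<in> A" for R a
    using X[of R] that by (auto simp: second_feasible_def A_def)
  have z01: "z a \<in> {0..1}" if a: "a \<in> A" for a
  proof -
    have X01': "0 \<le> X R a" "X R a \<le> 1" for R
      using X01[OF a, of R] by auto
    have "(\<Sum>R\<in>Pow A. subset_prob q A R * X R a) \<le> (\<Sum>R\<in>Pow A. subset_prob q A R * 1)"
      using pr X01' by (intro sum_mono mult_left_mono) auto
    moreover have "0 \<le> (\<Sum>R\<in>Pow A. subset_prob q A R * X R a)"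
      using pr X01' by (intro sum_nonneg mult_nonneg_nonneg) auto
    ultimately show ?thesis
      using a finA by (simp add: z_def sum_subset_prob)
  qed
  have cap: "(\<Sum>l'\<in>potentials M l. z (l, l')) \<le> real (capacity M l)" if l: "l \<in> users M" for l
  proof -
    have "(\<Sum>l'\<in>potentials M l. z (l, l'))
        = (\<Sum>l'\<in>potentials M l. \<Sum>R\<in>Pow A. subset_prob q A R * X R (l, l'))"
      using l by (intro sum.cong) (auto simp: z_def A_def arcs_iff)
    also have "\<dots> = (\<Sum>R\<in>Pow A. subset_prob q A R * (\<Sum>l'\<in>potentials M l. X R (l, l')))"
      by (subst sum.swap) (simp add: sum_distrib_left)
    also have "\<dots> \<le> (\<Sum>R\<in>Pow A. subset_prob q A R * real (capacity M l))"
      using X l pr by (intro sum_mono mult_left_mono) (auto simp: second_feasible_def)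
    also have "\<dots> = real (capacity M l)"
      using finA by (simp add: sum_distrib_right[symmetric] sum_subset_prob)
    finally show ?thesis .
  qed
  have backlog: "z (l, l') \<le> like1 M (l', l) * x1 (l', l)" if "(l, l') \<in> A" for l l'
  proof -
    have "z (l, l') = (\<Sum>R\<in>Pow A. subset_prob q A R * X R (l, l'))"
      using that by (simp add: z_def)
    \<comment> \<open>Only a realized like \<open>(l', l)\<close> lets \<open>l'\<close> be shown to
      \<open>l\<close>; its probability is the (DH-int) bound.\<close>
    also have "\<dots> \<le> (\<Sum>R\<in>Pow A. subset_prob q A R * of_bool ((l', l) \<in> R))"
    proof (intro sum_mono mult_left_mono pr)
      show "X R (l, l') \<le> of_bool ((l', l) \<in> R)" for R
        using X[of R] that unfolding second_feasible_def A_def by blast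
    qed auto
    also have "\<dots> = q (l', l)"
      using finA arcs_sym[OF M] that by (intro expectation_mem) (auto simp: A_def)
    finally show ?thesis
      by (simp add: q_def)
  qed
  have "(x1, w1, z) \<in> DH_feasible M d"
    unfolding DH_feasible_def using x1 z01 cap backlog
    by (auto simp: A_def arcs_iff z_def)
  moreover have "expected_second M x1
      = (\<Sum>l\<in>users M. \<Sum>l'\<in>potentials M l. like2 M (l, l') * z (l, l'))"
  proof -
    have "expected_second M x1 = (\<Sum>R\<in>Pow A. \<Sum>a\<in>A. subset_prob q A R * (like2 M a * X R a))"
      unfolding expected_second_eq val by (simp add: A_def q_def sum_distrib_left)
    also have "\<dots> = (\<Sum>a\<in>A. like2 M a * z a)"
      by (subst sum.swap) (simp add: z_def sum_distrib_left mult.left_commute)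
    finally show ?thesis
      using M by (simp add: A_def sum_arcs)
  qed
  ultimately show thesis
    using that by (simp add: two_period_value_def DH_value_def)
qed

text \<open>No second-period constraint couples two users, so their greedy selections together form
  a feasible decision for every \<open>R\<close>, and the single-user bounds add up.\<close>

lemma expected_second_ge:
  assumes M: "valid_market M" and DH: "(x1, w1, x2) \<in> DH_feasible M d"
  shows "(1 - 1 / exp 1) * (\<Sum>l\<in>users M. \<Sum>l'\<in>potentials M l. like2 M (l, l') * x2 (l, l'))
    \<le> expected_second M x1"
proof -
  define A where "A = arcs M"
  define q where "q = (\<lambda>a. like1 M a * x1 a)"
  \<comment> \<open>Arcs into \<open>l\<close>: likes on them form the backlog of \<open>l\<close>.
    Second-period arcs are their reversals, hence \<open>prod.swap\<close> below.\<close>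
  define B where "B = (\<lambda>l. (\<lambda>l'. (l', l)) ` potentials M l)"
  have x1: "(x1, w1) \<in> first_feasible M d"
    using DH by (simp add: DH_feasible_def)
  have finA: "finite A"
    using M by (simp add: A_def finite_arcs)
  have q: "q a \<in> {0..1}" if "a \<in> A" for a
    using like1_first_feasible[OF M x1] that by (simp add: q_def A_def)
  have sum_B: "(\<Sum>a\<in>B l. f a) = (\<Sum>l'\<in>potentials M l. f (l', l))" for l and f :: "_ \<Rightarrow> real"
    unfolding B_def by (subst sum.reindex) (auto simp: inj_on_def)
  have "\<exists>T. (\<forall>R\<subseteq>A. T R \<subseteq> R \<inter> B l \<and> card (T R) \<le> capacity M l) \<and>
      (1 - 1 / exp 1) * (\<Sum>l'\<in>potentials M l. like2 M (l, l') * x2 (l, l'))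
      \<le> (\<Sum>R\<in>Pow A. subset_prob q A R *
          (\<Sum>l'\<in>potentials M l. like2 M (l, l') * of_bool ((l', l) \<in> T R)))"
    if l: "l \<in> users M" for l
  proof -
    have arc: "(l, l') \<in> A" "(l', l) \<in> A" if "l' \<in> potentials M l" for l'
      using that l arcs_sym[OF M, of l l'] by (simp_all add: A_def arcs_iff)
    obtain T where "\<And>R. R \<subseteq> A \<Longrightarrow> T R \<subseteq> R \<inter> B l" "\<And>R. R \<subseteq> A \<Longrightarrow> card (T R) \<le> capacity M l"
      "(1 - 1 / exp 1) * (\<Sum>a\<in>B l. like2 M (prod.swap a) * x2 (prod.swap a))
      \<le> (\<Sum>R\<in>Pow A. subset_prob q A R * (\<Sum>a\<in>B l. like2 M (prod.swap a) * of_bool (a \<in> T R)))"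
    \<comment> \<open>The ground set is all of \<open>A\<close>, so that one realization
      \<open>R\<close> serves all users at once.\<close>
    proof (rule correlation_gap[where A = A and B = "B l" and K = "capacity M l" and q = q
          and v = "like2 M \<circ> prod.swap" and y = "x2 \<circ> prod.swap"])
      show "capacity M l > 0"
        using M l by (simp add: valid_market_def)
      show "sum (x2 \<circ> prod.swap) (B l) \<le> real (capacity M l)"
        using DH l by (simp add: sum_B DH_feasible_def)
      show "0 \<le> (like2 M \<circ> prod.swap) a" if "a \<in> B l" for a
        using that arc like_bounds[OF M] by (auto simp: B_def A_def)
      show "(x2 \<circ> prod.swap) a \<in> {0..q a}" if "a \<in> B l" for a
      proof -
        from that obtain l' where l': "a = (l', l)" "l' \<in> potentials M l"
          by (auto simp: B_def)
        then have "x2 (l, l') \<in> {0..1}"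
          using DH arc by (auto simp: DH_feasible_def A_def)
        then show ?thesis
          using DH l l' by (auto simp: DH_feasible_def q_def)
      qed
    qed (use finA q arc in \<open>auto simp: B_def\<close>)
    then show ?thesis
      unfolding sum_B swap_simp by blast
  qed
  then have "\<exists>T. \<forall>l\<in>users M. (\<forall>R\<subseteq>A. T l R \<subseteq> R \<inter> B l \<and> card (T l R) \<le> capacity M l) \<and>
      (1 - 1 / exp 1) * (\<Sum>l'\<in>potentials M l. like2 M (l, l') * x2 (l, l'))
      \<le> (\<Sum>R\<in>Pow A. subset_prob q A R *
          (\<Sum>l'\<in>potentials M l. like2 M (l, l') * of_bool ((l', l) \<in> T l R)))"
    by (intro bchoice ballI) blast
  then obtain T where T: "\<And>l R. l \<in> users M \<Longrightarrow> R \<subseteq> A \<Longrightarrow> T l R \<subseteq> R \<inter> B l"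
      "\<And>l R. l \<in> users M \<Longrightarrow> R \<subseteq> A \<Longrightarrow> card (T l R) \<le> capacity M l"
    and gap: "\<And>l. l \<in> users M \<Longrightarrow>
      (1 - 1 / exp 1) * (\<Sum>l'\<in>potentials M l. like2 M (l, l') * x2 (l, l'))
      \<le> (\<Sum>R\<in>Pow A. subset_prob q A R *
          (\<Sum>l'\<in>potentials M l. like2 M (l, l') * of_bool ((l', l) \<in> T l R)))"
    by blast
  have second: "(\<Sum>l\<in>users M. \<Sum>l'\<in>potentials M l. like2 M (l, l') * of_bool ((l', l) \<in> T l R))
      \<le> second_value M R" if R: "R \<subseteq> A" for R
  proof -
    \<comment> \<open>\<open>l\<close> sees \<open>l'\<close> exactly when the selection of
      \<open>l\<close> contains the like \<open>(l', l)\<close>.\<close>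
    define x where "x = (\<lambda>(l, l')\<in>A. of_bool ((l', l) \<in> T l R) :: real)"
    have x: "x (l, l') = of_bool ((l', l) \<in> T l R)" if "(l, l') \<in> A" for l l'
      using that by (simp add: x_def)
    have "(\<Sum>l'\<in>potentials M l. x (l, l')) \<le> real (capacity M l)" if l: "l \<in> users M" for l
    proof -
      have "finite (B l)"
        using l M by (simp add: B_def finite_potentials)
      have "(\<Sum>l'\<in>potentials M l. x (l, l')) = (\<Sum>a\<in>B l. of_bool (a \<in> T l R))"
        unfolding sum_B using l by (intro sum.cong) (auto simp: x A_def arcs_iff)
      also have "\<dots> = real (card (B l \<inter> T l R))"
        using \<open>finite (B l)\<close> by (simp add: of_bool_def sum.If_cases Int_def)
      also have "B l \<inter> T l R = T l R"
        using T(1)[OF l R] by blast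
      finally show ?thesis
        using T(2)[OF l R] by simp
    qed
    moreover have "x (l, l') \<le> of_bool ((l', l) \<in> R)" if "(l, l') \<in> A" for l l'
      using that T(1)[of l R] R by (auto simp: x A_def arcs_iff)
    moreover have "x \<in> A \<rightarrow>\<^sub>E {0, 1}"
      by (auto simp: x_def)
    ultimately have "x \<in> second_feasible M R"
      unfolding second_feasible_def A_def by blast
    then have "(\<Sum>a\<in>A. like2 M a * x a) \<le> second_value M R"
      using M by (simp add: A_def second_value_ge)
    also have "(\<Sum>a\<in>A. like2 M a * x a)
        = (\<Sum>l\<in>users M. \<Sum>l'\<in>potentials M l. like2 M (l, l') * of_bool ((l', l) \<in> T l R))"
      unfolding A_def sum_arcs[OF M] by (intro sum.cong) (auto simp: x A_def arcs_iff)
    finally show ?thesis .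
  qed
  have "(1 - 1 / exp 1) * (\<Sum>l\<in>users M. \<Sum>l'\<in>potentials M l. like2 M (l, l') * x2 (l, l'))
      \<le> (\<Sum>l\<in>users M. \<Sum>R\<in>Pow A. subset_prob q A R *
          (\<Sum>l'\<in>potentials M l. like2 M (l, l') * of_bool ((l', l) \<in> T l R)))"
    unfolding sum_distrib_left[of _ _ "users M"] by (intro sum_mono gap)
  also have "\<dots> = (\<Sum>R\<in>Pow A. subset_prob q A R *
      (\<Sum>l\<in>users M. \<Sum>l'\<in>potentials M l. like2 M (l, l') * of_bool ((l', l) \<in> T l R)))"
    by (subst sum.swap) (simp add: sum_distrib_left)
  also have "\<dots> \<le> (\<Sum>R\<in>Pow A. subset_prob q A R * second_value M R)"
    using second q by (intro sum_mono mult_left_mono subset_prob_nonneg) auto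
  also have "\<dots> = expected_second M x1"
    by (simp add: expected_second_eq A_def q_def)
  finally show ?thesis .
qed

theorem theorem4p3:
  fixes M :: "'u market" and d :: design
    and x1 x2 :: "'u \<times> 'u \<Rightarrow> real" and w1 :: "'u set \<Rightarrow> real"
  assumes "valid_market M"
    and "DH_optimal M d x1 w1 x2"
  shows "(\<Sum>e\<in>edges M. beta1 M e * w1 e) + expected_second M x1
           \<ge> (1 - 1 / exp 1) * OPT M d"
proof -
  define W where "W = (\<Sum>e\<in>edges M. beta1 M e * w1 e)"
  define L where "L = (\<Sum>l\<in>users M. \<Sum>l'\<in>potentials M l. like2 M (l, l') * x2 (l, l'))"
  have DH: "(x1, w1, x2) \<in> DH_feasible M d"
    using assms(2) by (simp add: DH_optimal_def)
  have "OPT M d \<in> (\<lambda>(x1, w1). two_period_value M x1 w1) ` first_feasible M d"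
    unfolding OPT_def using assms(1)
    by (intro Max_in) (auto simp: finite_first_feasible first_feasible_nonempty)
  then obtain y1 v1 where "(y1, v1) \<in> first_feasible M d" and opt: "OPT M d = two_period_value M y1 v1"
    by auto
  then obtain y2 where "(y1, v1, y2) \<in> DH_feasible M d" "OPT M d = DH_value M v1 y2"
    using two_period_value_eq_DH[OF assms(1)] by metis
  then have "OPT M d \<le> W + L"
    using assms(2) by (fastforce simp: DH_optimal_def DH_value_def W_def L_def)
  then have "(1 - 1 / exp 1) * OPT M d \<le> (1 - 1 / exp 1) * (W + L)"
    by (intro mult_left_mono) auto
  also have "\<dots> \<le> W + (1 - 1 / exp 1) * L"
  proof -
    have "w1 e \<in> {0, 1}" if "e \<in> edges M" for e
      using DH that by (auto simp: DH_feasible_def first_feasible_def)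
    then have "0 \<le> W"
      unfolding W_def using beta1_nonneg[OF assms(1)]
      by (intro sum_nonneg mult_nonneg_nonneg) force+
    then have "(1 - 1 / exp 1) * W \<le> 1 * W"
      by (intro mult_right_mono) auto
    then show ?thesis
      by (simp add: distrib_left)
  qed
  also have "\<dots> \<le> W + expected_second M x1"
    using expected_second_ge[OF assms(1) DH] by (simp add: L_def)
  finally show ?thesis
    by (simp add: W_def)
qed

end
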